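(* Let $A$ be an $n\times n$ real skew-symmetric matrix and let $B$ be an $(n-1)\times(n-1)$ principal submatrix of $A$. Then $\sigma(B)$ interlaces $\sigma(A)$.
   Context: All eigenvalues of a real skew-symmetric matrix lie in $\mathrm{i}\mathbb{R}=\{\mathrm{i}a: a\in\mathbb{R}\}$, where $\mathrm{i}=\sqrt{-1}$. Order on $\mathrm{i}\mathbb{R}$: for $a,b\in \mathrm{i}\mathbb{R}$, $a\le b$ means $-\mathrm{i}a\le -\mathrm{i}b$ as real numbers. $\sigma(\cdot)$ denotes the spectrum, i.e. the eigenvalues listed with multiplicity, presented in increasing order with respect to this order. If $\mathcal{A}=\{\lambda_1,\ldots,\lambda_n\}$ and $\mathcal{B}=\{\mu_1,\ldots,\mu_{n-1}\}$ are contained in $\mathrm{i}\mathbb{R}$ and presented in increasing order, then $\mathcal{B}$ interlaces $\mathcal{A}$ if $\lambda_1\le\mu_1\le\lambda_2\le\cdots\le\mu_{n-1}\le\lambda_n$. *)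

theory Defs
  imports
    Complex_Main
    "HOL-Library.Multiset"
    "HOL-Computational_Algebra.Polynomial"
    "Jordan_Normal_Form.Char_Poly"
    "Jordan_Normal_Form.DL_Submatrix"
begin

definition skew_symmetric_mat :: "real mat \<Rightarrow> bool" where
  "skew_symmetric_mat A \<longleftrightarrow> square_mat A \<and> transpose_mat A = - A"

definition principal_submatrix :: "'a mat \<Rightarrow> 'a mat \<Rightarrow> bool" where
  "principal_submatrix B A \<longleftrightarrow>
     square_mat A \<and> (\<exists>I \<subseteq> {..<dim_row A}. B = submatrix A I I)"

definition imaginary_axis :: "complex set" where
  "imaginary_axis = {\<i> * complex_of_real a |a. True}"

text \<open>The order is meant for arguments on the imaginary axis, where \<open>- \<i> * a\<close> and
  \<open>- \<i> * b\<close> are real, so that taking real parts discards nothing.\<close>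

definition imag_le :: "complex \<Rightarrow> complex \<Rightarrow> bool" where
  "imag_le a b \<longleftrightarrow> Re (- \<i> * a) \<le> Re (- \<i> * b)"

text \<open>The complex eigenvalues of a real matrix, with multiplicity. The arrangement in
  increasing order is supplied by \<open>interlaces\<close>.\<close>

definition eigenvalue_mset :: "real mat \<Rightarrow> complex multiset" where
  "eigenvalue_mset A = proots (char_poly (map_mat complex_of_real A))"

text \<open>On the imaginary axis \<open>imag_le\<close> is a linear order, so a finite multiset of purely
  imaginary numbers has exactly one increasing listing; hence the existential quantifier
  below makes no choice. Indices are 0-based.\<close>

definition interlaces :: "complex multiset \<Rightarrow> complex multiset \<Rightarrow> bool" where
  "interlaces \<B> \<A> \<longleftrightarrow>
     set_mset \<A> \<subseteq> imaginary_axis \<and> set_mset \<B> \<subseteq> imaginary_axis \<and>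
     (\<exists>ls ms. mset ls = \<A> \<and> sorted_wrt imag_le ls \<and>
              mset ms = \<B> \<and> sorted_wrt imag_le ms \<and>
              length ls = Suc (length ms) \<and>
              (\<forall>k < length ms. imag_le (ls ! k) (ms ! k) \<and> imag_le (ms ! k) (ls ! Suc k)))"

end

theory Submission
  imports
    Defs
    "Jordan_Normal_Form.Schur_Decomposition"
begin

text \<open>A skew-Hermitian matrix is unitarily diagonalizable with purely imaginary eigenvalues:
  a unitary Schur form that is skew-Hermitian is diagonal. A principal submatrix of \<open>A\<close> is
  \<open>E\<^sup>* A E\<close> for a coordinate isometry \<open>E\<close>, so in eigenbases of both matrices one obtains an
  isometry \<open>X\<close> with \<open>X\<^sup>* diag(l) X = diag(u)\<close>. If \<open>u k < l k\<close>, then among the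
  combinations of the first \<open>k + 1\<close> columns of \<open>X\<close> there is a nonzero vector whose first \<open>k\<close>
  entries vanish; its Rayleigh quotient would be at most \<open>u k\<close> and at least \<open>l k\<close>. The
  other inequality is the same argument for the negated eigenvalues.\<close>

section \<open>Eigenvalue comparison for diagonal forms under an isometry\<close>

text \<open>Gaussian elimination, by induction on the equations: an equation with zero coefficients
  is dropped, any other one eliminates an unknown. Arbitrary finite index sets allow its use on a
  subset of the rows and columns of a larger matrix.\<close>

lemma homogeneous_system_nontrivial_solution:
  fixes a :: "'r \<Rightarrow> 'i \<Rightarrow> 'a :: field"
  assumes "finite R" "finite T" "card R < card T"
  shows "\<exists>c. (\<exists>i\<in>T. c i \<noteq> 0) \<and> (\<forall>r\<in>R. (\<Sum>i\<in>T. a r i * c i) = 0)"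
  using assms
proof (induction R arbitrary: a T rule: finite_induct)
  case empty
  then have "T \<noteq> {}" by auto
  then show ?case by (intro exI[of _ "\<lambda>_. 1"]) auto
next
  case (insert r R)
  show ?case
  proof (cases "\<forall>i\<in>T. a r i = 0")
    case True
    with insert.IH[of T a] insert.prems insert.hyps show ?thesis by (auto simp: Suc_lessD)
  next
    case False
    then obtain j where j: "j \<in> T" "a r j \<noteq> 0" by auto
    \<comment> \<open>The coefficients left after equation \<open>r\<close> has been used to
      eliminate the unknown \<open>j\<close>.\<close>
    define b where "b s i = a s i - a s j * a r i / a r j" for s i
    have "card R < card (T - {j})" using insert.prems insert.hyps j by simp
    then obtain c where c: "\<exists>i\<in>T - {j}. c i \<noteq> 0" "\<forall>s\<in>R. (\<Sum>i\<in>T - {j}. b s i * c i) = 0"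
      using insert.IH[of "T - {j}" b] insert.prems by auto
    \<comment> \<open>Back substitution: the value at \<open>j\<close> is the one that makes
      equation \<open>r\<close> hold.\<close>
    define d where "d = c(j := - (\<Sum>i\<in>T - {j}. a r i * c i) / a r j)"
    have split: "(\<Sum>i\<in>T. a s i * d i) = a s j * d j + (\<Sum>i\<in>T - {j}. a s i * c i)" for s
      using insert.prems(1) j by (subst sum.remove[of T j]) (auto simp: d_def intro!: sum.cong)
    have "(\<Sum>i\<in>T. a s i * d i) = 0" if "s \<in> R" for s
    proof -
      have "(\<Sum>i\<in>T - {j}. b s i * c i)
          = (\<Sum>i\<in>T - {j}. a s i * c i) - (\<Sum>i\<in>T - {j}. a s j / a r j * (a r i * c i))"
        by (simp add: b_def algebra_simps sum_subtractf)
      with c(2) that show ?thesis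
        unfolding split by (simp add: d_def sum_distrib_left sum_divide_distrib)
    qed
    moreover have "(\<Sum>i\<in>T. a r i * d i) = 0" unfolding split using j by (simp add: d_def)
    moreover have "\<exists>i\<in>T. d i \<noteq> 0" using c(1) by (auto simp: d_def)
    ultimately show ?thesis by blast
  qed
qed

text \<open>Each squared modulus is a conjugate times the number itself, so the left side expands
  into a double sum over \<open>T\<close>, whose off-diagonal terms vanish by \<open>diag\<close>.
  Weights 1 give preservation of norms; weights \<open>l r - t\<close> give the shifted form used
  for comparing eigenvalues.\<close>

lemma diagonalized_form_value:
  fixes X :: "'r \<Rightarrow> 'i \<Rightarrow> complex" and w :: "'r \<Rightarrow> real" and v :: "'i \<Rightarrow> real"
  assumes "finite N" "finite T"
    and diag: "\<And>i j. i \<in> T \<Longrightarrow> j \<in> T \<Longrightarrow>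
      (\<Sum>r\<in>N. cnj (X r i) * X r j * of_real (w r)) = (if i = j then of_real (v i) else 0)"
  shows "(\<Sum>r\<in>N. w r * (cmod (\<Sum>i\<in>T. X r i * c i))\<^sup>2) = (\<Sum>i\<in>T. v i * (cmod (c i))\<^sup>2)"
proof -
  have "complex_of_real (\<Sum>r\<in>N. w r * (cmod (\<Sum>i\<in>T. X r i * c i))\<^sup>2)
      = (\<Sum>r\<in>N. \<Sum>i\<in>T. \<Sum>j\<in>T. of_real (w r) * (cnj (X r i * c i) * (X r j * c j)))"
    by (simp only: of_real_sum of_real_mult complex_norm_square cnj_sum sum_product
        sum_distrib_left mult.commute[of _ "cnj _"])
  also have "\<dots> = (\<Sum>i\<in>T. \<Sum>j\<in>T. \<Sum>r\<in>N. of_real (w r) * (cnj (X r i * c i) * (X r j * c j)))"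
    by (subst sum.swap) (intro sum.cong refl sum.swap)
  also have "\<dots> = (\<Sum>i\<in>T. \<Sum>j\<in>T. cnj (c i) * c j * (\<Sum>r\<in>N. cnj (X r i) * X r j * of_real (w r)))"
    by (simp add: sum_distrib_left ac_simps)
  also have "\<dots> = (\<Sum>i\<in>T. \<Sum>j\<in>T. if i = j then cnj (c i) * c j * of_real (v i) else 0)"
    by (intro sum.cong refl) (simp add: diag)
  also have "\<dots> = (\<Sum>i\<in>T. cnj (c i) * c i * of_real (v i))"
    using assms(2) by simp
  also have "\<dots> = of_real (\<Sum>i\<in>T. v i * (cmod (c i))\<^sup>2)"
    by (simp only: of_real_sum of_real_mult complex_norm_square ac_simps)
  finally show ?thesis by (simp only: of_real_eq_iff)
qed

text \<open>The half of the min-max principle that both inequalities share. Vanishing outside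
  \<open>S\<close> imposes fewer conditions than there are columns in \<open>T\<close>, so some
  nontrivial combination of these columns is supported in \<open>S\<close>. The choice of
  \<open>S\<close> and \<open>T\<close> is left to the application.\<close>

lemma compression_eigenvalue_comparison:
  fixes X :: "'r \<Rightarrow> 'i \<Rightarrow> complex" and l :: "'r \<Rightarrow> real" and u :: "'i \<Rightarrow> real"
  assumes fin: "finite N" "finite T"
    and isometry: "\<And>i j. i \<in> T \<Longrightarrow> j \<in> T \<Longrightarrow>
      (\<Sum>r\<in>N. cnj (X r i) * X r j) = (if i = j then 1 else 0)"
    and diag: "\<And>i j. i \<in> T \<Longrightarrow> j \<in> T \<Longrightarrow>
      (\<Sum>r\<in>N. cnj (X r i) * X r j * of_real (l r)) = (if i = j then of_real (u i) else 0)"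
    and card: "card (N - S) < card T"
  shows "\<exists>r\<in>N \<inter> S. \<exists>i\<in>T. l r \<le> u i"
proof (rule ccontr)
  assume "\<not> ?thesis"
  then have less: "u i < l r" if "r \<in> N" "r \<in> S" "i \<in> T" for r i
    using that by (meson IntI not_le)
  obtain c where c: "\<exists>i\<in>T. c i \<noteq> 0" "\<And>r. r \<in> N - S \<Longrightarrow> (\<Sum>i\<in>T. X r i * c i) = 0"
    using homogeneous_system_nontrivial_solution[of "N - S" T X] fin card by blast
  define y where "y r = (\<Sum>i\<in>T. X r i * c i)" for r
  \<comment> \<open>The level \<open>t\<close> separates the \<open>u i\<close> from the
    \<open>l r\<close> with \<open>r\<close> in \<open>S\<close>. Subtracting it reduces the
    comparison of Rayleigh quotients to a comparison of signs.\<close>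
  define t where "t = Max (u ` T)"
  have T: "T \<noteq> {}" using card by auto
  have t_ge: "u i \<le> t" if "i \<in> T" for i
    unfolding t_def using that fin by simp
  have t_less: "t < l r" if "r \<in> N" "r \<in> S" for r
    unfolding t_def using that fin T less by simp
  \<comment> \<open>Weights 1: the isometry preserves the norm, so \<open>c\<close> being nonzero
    makes \<open>y\<close> nonzero.\<close>
  have "(\<Sum>r\<in>N. 1 * (cmod (y r))\<^sup>2) = (\<Sum>i\<in>T. 1 * (cmod (c i))\<^sup>2)"
    unfolding y_def using isometry fin by (intro diagonalized_form_value) auto
  moreover have "(\<Sum>i\<in>T. 1 * (cmod (c i))\<^sup>2) > 0"
    using c(1) fin by (auto intro: sum_pos2)
  ultimately obtain s where s: "s \<in> N" "y s \<noteq> 0"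
    by (metis (mono_tags, lifting) less_irrefl mult_zero_right norm_zero sum.neutral zero_power2)
  have sS: "s \<in> S" using c(2) s by (auto simp: y_def)
  have "(\<Sum>r\<in>N. (l r - t) * (cmod (y r))\<^sup>2) = (\<Sum>i\<in>T. (u i - t) * (cmod (c i))\<^sup>2)"
    unfolding y_def
  proof (rule diagonalized_form_value[OF fin])
    fix i j assume ij: "i \<in> T" "j \<in> T"
    have "(\<Sum>r\<in>N. cnj (X r i) * X r j * of_real (l r - t))
        = (\<Sum>r\<in>N. cnj (X r i) * X r j * of_real (l r)) - (\<Sum>r\<in>N. cnj (X r i) * X r j) * of_real t"
      by (simp add: algebra_simps sum_subtractf sum_distrib_left)
    then show "(\<Sum>r\<in>N. cnj (X r i) * X r j * of_real (l r - t))
        = (if i = j then of_real (u i - t) else 0)"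
      using ij by (simp add: isometry diag)
  qed
  also have "\<dots> \<le> 0"
    using t_ge by (intro sum_nonpos mult_nonpos_nonneg) auto
  \<comment> \<open>Outside \<open>S\<close> the factor \<open>l r - t\<close> may be negative, but
    there \<open>y r\<close> is zero.\<close>
  moreover have "(\<Sum>r\<in>N. (l r - t) * (cmod (y r))\<^sup>2) > 0"
  proof (rule sum_pos2[OF fin(1) s(1)])
    show "0 < (l s - t) * (cmod (y s))\<^sup>2" using t_less[OF s(1) sS] s(2) by simp
    show "0 \<le> (l r - t) * (cmod (y r))\<^sup>2" if "r \<in> N" for r
      using t_less[of r] c(2)[of r] that by (cases "r \<in> S") (auto simp: y_def)
  qed
  ultimately show False by simp
qed

lemma cauchy_interlacing_diagonal:
  fixes X :: "nat \<Rightarrow> nat \<Rightarrow> complex" and l u :: "nat \<Rightarrow> real"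
  assumes isometry: "\<And>i j. i < m \<Longrightarrow> j < m \<Longrightarrow>
      (\<Sum>r<n. cnj (X r i) * X r j) = (if i = j then 1 else 0)"
    and diag: "\<And>i j. i < m \<Longrightarrow> j < m \<Longrightarrow>
      (\<Sum>r<n. cnj (X r i) * X r j * of_real (l r)) = (if i = j then of_real (u i) else 0)"
    and mono_l: "\<And>i j. i \<le> j \<Longrightarrow> j < n \<Longrightarrow> l i \<le> l j"
    and mono_u: "\<And>i j. i \<le> j \<Longrightarrow> j < m \<Longrightarrow> u i \<le> u j"
    and "m \<le> n" "k < m"
  shows "l k \<le> u k" "u k \<le> l (k + (n - m))"
proof -
  \<comment> \<open>The count for the lower bound: \<open>k\<close> conditions against the
    \<open>k + 1\<close> columns in \<open>{..k}\<close>.\<close>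
  have "{..<n} - {k..} = {..<k}" using \<open>k < m\<close> \<open>m \<le> n\<close> by auto
  then have "\<exists>r\<in>{..<n} \<inter> {k..}. \<exists>i\<in>{..k}. l r \<le> u i"
    using isometry diag \<open>k < m\<close> by (intro compression_eigenvalue_comparison[where X = X]) auto
  then obtain r i where "k \<le> r" "r < n" "i \<le> k" "l r \<le> u i" by auto
  then show "l k \<le> u k"
    using mono_l[of k r] mono_u[of i k] \<open>k < m\<close> by linarith
  \<comment> \<open>The count for the upper bound, applied to \<open>- l\<close> and
    \<open>- u\<close>: \<open>m - k - 1\<close> conditions against the \<open>m - k\<close> columns
    in \<open>{k..<m}\<close>.\<close>
  have "{..<n} - {..k + (n - m)} = {Suc (k + (n - m))..<n}" by auto
  then have "\<exists>r\<in>{..<n} \<inter> {..k + (n - m)}. \<exists>i\<in>{k..<m}. - l r \<le> - u i"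
    using isometry diag \<open>k < m\<close> \<open>m \<le> n\<close>
    by (intro compression_eigenvalue_comparison[where X = X]) (auto simp: sum_negf)
  then obtain r i where "r \<le> k + (n - m)" "k \<le> i" "i < m" "u i \<le> l r" by auto
  then show "u k \<le> l (k + (n - m))"
    using mono_l[of r "k + (n - m)"] mono_u[of k i] \<open>k < m\<close> \<open>m \<le> n\<close> by linarith
qed

section \<open>Adjoints, congruences and isometries\<close>

lemma index_mult_mat_sum:
  assumes "A \<in> carrier_mat n m" "B \<in> carrier_mat m k" "i < n" "j < k"
  shows "(A * B) $$ (i, j) = (\<Sum>r<m. A $$ (i, r) * B $$ (r, j))"
  using assms by (simp add: scalar_prod_def atLeast0LessThan)

lemma mat_adjoint_carrier [simp, intro]:
  "A \<in> carrier_mat n m \<Longrightarrow> mat_adjoint A \<in> carrier_mat m n"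
  unfolding mat_adjoint_def by (auto simp: mat_of_rows_def)

lemma index_mat_adjoint [simp]:
  "i < dim_col A \<Longrightarrow> j < dim_row A \<Longrightarrow> mat_adjoint A $$ (i, j) = conjugate (A $$ (j, i))"
  unfolding mat_adjoint_def by (simp add: mat_of_rows_index)

lemma dim_mat_adjoint [simp]:
  "dim_row (mat_adjoint A) = dim_col A" "dim_col (mat_adjoint A) = dim_row A"
  unfolding mat_adjoint_def by auto

lemma mat_adjoint_mat_adjoint [simp]: "mat_adjoint (mat_adjoint A) = A"
  by (rule eq_matI) auto

lemma mat_adjoint_mult:
  assumes "A \<in> carrier_mat n m" "B \<in> carrier_mat m k"
  shows "mat_adjoint (A * B) = mat_adjoint B * mat_adjoint A"
  using assms
  by (intro eq_matI)
    (auto simp: scalar_prod_def sum_conjugate conjugate_dist_mul mult.commute intro!: sum.cong)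

lemma mat_adjoint_congruence_mult:
  assumes V: "V \<in> carrier_mat n m" and W: "W \<in> carrier_mat m k" and A: "A \<in> carrier_mat n n"
  shows "mat_adjoint (V * W) * A * (V * W) = mat_adjoint W * (mat_adjoint V * A * V) * W"
proof -
  note carr = V W A mat_adjoint_carrier[OF V] mat_adjoint_carrier[OF W]
  have "mat_adjoint (V * W) * A = mat_adjoint W * (mat_adjoint V * A)"
    unfolding mat_adjoint_mult[OF V W] using carr by (intro assoc_mult_mat)
  then have "mat_adjoint (V * W) * A * (V * W) = mat_adjoint W * (mat_adjoint V * A) * (V * W)"
    by simp
  also have "\<dots> = mat_adjoint W * (mat_adjoint V * A) * V * W"
    using carr by (intro assoc_mult_mat[symmetric] mult_carrier_mat)
  also have "mat_adjoint W * (mat_adjoint V * A) * V = mat_adjoint W * (mat_adjoint V * A * V)"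
    using carr by (intro assoc_mult_mat mult_carrier_mat)
  finally show ?thesis .
qed

definition isometry_mat :: "complex mat \<Rightarrow> bool" where
  "isometry_mat U \<longleftrightarrow> mat_adjoint U * U = 1\<^sub>m (dim_col U)"

lemma isometry_mat_iff:
  assumes "U \<in> carrier_mat n m"
  shows "isometry_mat U \<longleftrightarrow>
    (\<forall>i<m. \<forall>j<m. (\<Sum>r<n. cnj (U $$ (r, i)) * U $$ (r, j)) = (if i = j then 1 else 0))"
  using assms unfolding isometry_mat_def
  by (auto simp: mat_eq_iff scalar_prod_def atLeast0LessThan)

lemma isometry_mat_mult:
  assumes U: "U \<in> carrier_mat n m" "isometry_mat U" and V: "V \<in> carrier_mat m k" "isometry_mat V"
  shows "isometry_mat (U * V)"
proof -
  \<comment> \<open>With the identity in the middle, the congruence rule computes Gram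
    matrices.\<close>
  have "mat_adjoint (U * V) * 1\<^sub>m n * (U * V) = mat_adjoint V * (mat_adjoint U * 1\<^sub>m n * U) * V"
    using U(1) V(1) by (intro mat_adjoint_congruence_mult) auto
  then have "mat_adjoint (U * V) * (U * V) = mat_adjoint V * (mat_adjoint U * U) * V"
    using U(1) V(1) by simp
  also have "\<dots> = 1\<^sub>m k"
    using U V unfolding isometry_mat_def by simp
  finally show ?thesis using V(1) unfolding isometry_mat_def by simp
qed

lemma isometry_mat_adjoint:
  assumes U: "U \<in> carrier_mat n n" "isometry_mat U"
  shows "U * mat_adjoint U = 1\<^sub>m n" "isometry_mat (mat_adjoint U)"
proof -
  show "U * mat_adjoint U = 1\<^sub>m n"
    using mat_mult_left_right_inverse[OF mat_adjoint_carrier[OF U(1)] U(1)] U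
    by (simp add: isometry_mat_def)
  then show "isometry_mat (mat_adjoint U)"
    using U by (simp add: isometry_mat_def)
qed

section \<open>Unitary triangularization with a prescribed diagonal\<close>

text \<open>Extend \<open>v\<close> to a basis, orthogonalize by Gram-Schmidt, which leaves the
  first vector unchanged, and normalize. The scalar \<open>a\<close> is the normalizing factor; any
  multiple of an eigenvector serves the later induction.\<close>

lemma isometry_mat_completion:
  fixes v :: "complex vec"
  assumes v: "v \<in> carrier_vec n" "v \<noteq> 0\<^sub>v n"
  shows "\<exists>W a. W \<in> carrier_mat n n \<and> isometry_mat W \<and> col W 0 = a \<cdot>\<^sub>v v"
proof -
  interpret cof_vec_space n "TYPE(complex)" .
  note b = basis_completion[OF v]
  have n: "n \<noteq> 0"
  proof
    assume "n = 0"
    then have "v = 0\<^sub>v n" using v(1) by (intro eq_vecI) auto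
    then show False using v(2) by simp
  qed
  obtain vs where bv: "basis_completion v = v # vs"
    using b(6,7) n by (cases "basis_completion v") auto
  define ws where "ws = gram_schmidt n (basis_completion v)"
  note gs = gram_schmidt_result[OF b(2,4,5) ws_def]
  have len: "length ws = n" using gs(4) b(6) by simp
  have ws0: "ws ! 0 = v"
    using gram_schmidt_hd[OF v(1), of vs] len n hd_conv_nth[of ws] unfolding ws_def bv
    by (metis list.size(3))
  have carr: "ws ! i \<in> carrier_vec n" if "i < n" for i using gs(3) len that by auto
  define c where "c i = complex_of_real (1 / sqrt (Re (ws ! i \<bullet>c ws ! i)))" for i
  define W where "W = mat n n (\<lambda>(r, i). c i * ws ! i $ r)"
  have W: "W \<in> carrier_mat n n" unfolding W_def by simp
  have cnj_c: "cnj (c i) = c i" for i unfolding c_def by (rule complex_cnj_complex_of_real)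
  \<comment> \<open>The indices swap because \<open>\<bullet>c\<close> conjugates its second
    argument.\<close>
  have ip: "(\<Sum>r<n. cnj (W $$ (r, i)) * W $$ (r, j)) = c i * c j * (ws ! j \<bullet>c ws ! i)"
    if "i < n" "j < n" for i j
    using that carr[OF that(1)] carr[OF that(2)]
    by (simp add: W_def cnj_c scalar_prod_def sum_distrib_left atLeast0LessThan ac_simps)
  have orth: "ws ! j \<bullet>c ws ! i = 0 \<longleftrightarrow> i \<noteq> j" if "i < n" "j < n" for i j
    using corthogonalD[OF gs(2), of j i] that len by auto
  have "c i * c i * (ws ! i \<bullet>c ws ! i) = 1" if i: "i < n" for i
  proof -
    \<comment> \<open>The order on complex numbers requires equal imaginary parts, so this also says
      that the product is real.\<close>
    have "0 \<le> ws ! i \<bullet>c ws ! i" by (rule conjugate_square_ge_0_vec)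
    with orth[OF i i] have pos: "Re (ws ! i \<bullet>c ws ! i) > 0" "Im (ws ! i \<bullet>c ws ! i) = 0"
      by (auto simp: less_eq_complex_def complex_eq_iff)
    then have "1 / sqrt (Re (ws ! i \<bullet>c ws ! i)) * (1 / sqrt (Re (ws ! i \<bullet>c ws ! i)))
        = 1 / Re (ws ! i \<bullet>c ws ! i)"
      by (simp add: times_divide_times_eq)
    then have "c i * c i = complex_of_real (1 / Re (ws ! i \<bullet>c ws ! i))"
      unfolding c_def of_real_mult[symmetric] by (rule arg_cong)
    with pos show ?thesis by (simp add: complex_eq_iff)
  qed
  then have "isometry_mat W"
    using orth by (auto simp: isometry_mat_iff[OF W] ip)
  moreover have "col W 0 = c 0 \<cdot>\<^sub>v v"
    using n v(1) ws0 by (intro eq_vecI) (auto simp: W_def)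
  ultimately show ?thesis using W by blast
qed

text \<open>Induction on the list of eigenvalues: a unitary matrix whose first column is an
  eigenvector for \<open>e\<close> splits off \<open>e\<close>, and the remaining block is
  triangularized by the induction hypothesis. The diagonal follows the order of \<open>es\<close>,
  so a sorted list yields a sorted diagonal.\<close>

lemma unitary_schur_decomposition:
  fixes A :: "complex mat"
  assumes "A \<in> carrier_mat n n" "char_poly A = (\<Prod>e\<leftarrow>es. [:- e, 1:])"
  shows "\<exists>U \<in> carrier_mat n n. isometry_mat U \<and>
    upper_triangular (mat_adjoint U * A * U) \<and> diag_mat (mat_adjoint U * A * U) = es"
  using assms
proof (induction es arbitrary: n A)
  case Nil
  then have "n = 0" using degree_monic_char_poly[of A n] by simp
  with Nil show ?case
    by (intro bexI[of _ "1\<^sub>m 0"]) (auto simp: isometry_mat_def diag_mat_def upper_triangular_def)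
next
  case (Cons e es)
  note A = Cons.prems(1)
  have "degree (char_poly A) = n" using degree_monic_char_poly[OF A] by simp
  moreover have "degree (char_poly A) = length (e # es)"
    unfolding Cons.prems(2) by (rule degree_linear_factors)
  ultimately obtain m where n: "n = Suc m" by auto
  have "eigenvalue A e"
    unfolding eigenvalue_root_char_poly[OF A] Cons.prems(2) by simp
  then obtain v where v: "v \<in> carrier_vec n" "v \<noteq> 0\<^sub>v n" and Av: "A *\<^sub>v v = e \<cdot>\<^sub>v v"
    using A unfolding eigenvalue_def eigenvector_def by auto
  from isometry_mat_completion[OF v] obtain W a
    where W: "W \<in> carrier_mat n n" "isometry_mat W" and W0: "col W 0 = a \<cdot>\<^sub>v v" by blast
  define A' where "A' = mat_adjoint W * A * W"
  have A': "A' \<in> carrier_mat n n" unfolding A'_def using A W by (simp add: mult_carrier_mat[of _ n n _ n])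
  have WW: "mat_adjoint W * W = 1\<^sub>m n" using W by (simp add: isometry_mat_def)
  have "similar_mat A' A"
    by (rule similar_matI[of _ _ "mat_adjoint W" W n])
      (use A A' W WW isometry_mat_adjoint(1)[OF W] in \<open>auto simp: A'_def\<close>)
  then have cp: "char_poly A' = (\<Prod>e\<leftarrow>e # es. [:- e, 1:])"
    using char_poly_similar Cons.prems(2) by metis
  have n0: "0 < n" using n by simp
  have W': "mat_adjoint W \<in> carrier_mat n n" and AW: "A * W \<in> carrier_mat n n"
    using W(1) mult_carrier_mat[OF A W(1)] by auto
  have W0_carr: "col W 0 \<in> carrier_vec n" using n0 W(1) by (rule col_carrier_vec)
  have AW0: "A *\<^sub>v col W 0 = e \<cdot>\<^sub>v col W 0"
    unfolding W0 mult_mat_vec[OF A v(1)] Av by (simp add: smult_smult_assoc mult.commute)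
  have "A' = mat_adjoint W * (A * W)"
    unfolding A'_def using W' A W(1) by (rule assoc_mult_mat)
  then have "col A' 0 = mat_adjoint W *\<^sub>v (e \<cdot>\<^sub>v col W 0)"
    using col_mult2[OF W' AW n0] col_mult2[OF A W(1) n0] AW0 by (simp only:)
  also have "\<dots> = e \<cdot>\<^sub>v col (mat_adjoint W * W) 0"
    unfolding mult_mat_vec[OF W' W0_carr] col_mult2[OF W' W(1) n0] ..
  also have "\<dots> = e \<cdot>\<^sub>v unit_vec n 0"
    unfolding WW using n0 by simp
  finally have col_A': "col A' 0 = e \<cdot>\<^sub>v unit_vec n 0" .
  have col0: "A' $$ (i, 0) = (if i = 0 then e else 0)" if "i < n" for i
    using arg_cong[OF col_A', of "\<lambda>w. w $ i"] that A' n0 by auto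
  define A1 where "A1 = mat 1 1 (\<lambda>_. e)"
  define A2 where "A2 = mat 1 m (\<lambda>(_, j). A' $$ (0, Suc j))"
  define A3 where "A3 = mat m m (\<lambda>(i, j). A' $$ (Suc i, Suc j))"
  have carr: "A1 \<in> carrier_mat 1 1" "A2 \<in> carrier_mat 1 m" "A3 \<in> carrier_mat m m"
    unfolding A1_def A2_def A3_def by auto
  have A'_block: "A' = four_block_mat A1 A2 (0\<^sub>m m 1) A3"
    using A' n col0 carr by (intro eq_matI) (auto simp: A1_def A2_def A3_def)
  \<comment> \<open>The block form factors the characteristic polynomial; cancelling the factor of
    \<open>e\<close> leaves \<open>A3\<close> with exactly the roots in \<open>es\<close>.\<close>
  have "char_poly A1 * char_poly A3 = [:- e, 1:] * (\<Prod>e\<leftarrow>es. [:- e, 1:])"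
    using cp char_poly_four_block_zeros_col[OF carr] unfolding A'_block by simp
  moreover have "char_poly A1 = [:- e, 1:]"
    by (simp add: A1_def char_poly_defs det_def sign_def)
  ultimately have "char_poly A3 = (\<Prod>e\<leftarrow>es. [:- e, 1:])"
    by (metis mult_cancel_left pCons_eq_0_iff zero_neq_one)
  from Cons.IH[OF carr(3) this] obtain V where V: "V \<in> carrier_mat m m" "isometry_mat V"
    and T: "upper_triangular (mat_adjoint V * A3 * V)" "diag_mat (mat_adjoint V * A3 * V) = es"
    by blast
  \<comment> \<open>The direct sum of 1 and \<open>V\<close> acts only on the trailing block and
    keeps the first column; the final unitary matrix is \<open>W * F\<close>.\<close>
  define F where "F = four_block_mat (1\<^sub>m 1) (0\<^sub>m 1 m) (0\<^sub>m m 1) V"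
  have F: "F \<in> carrier_mat n n"
    unfolding F_def n using V by (metis four_block_carrier_mat one_carrier_mat plus_1_eq_Suc)
  have F_adj: "mat_adjoint F = four_block_mat (1\<^sub>m 1) (0\<^sub>m 1 m) (0\<^sub>m m 1) (mat_adjoint V)"
    unfolding F_def using V by (intro eq_matI) auto
  have V': "mat_adjoint V \<in> carrier_mat m m" using V by simp
  have "mat_adjoint F * F = four_block_mat (1\<^sub>m 1) (0\<^sub>m 1 m) (0\<^sub>m m 1) (1\<^sub>m m)"
    unfolding F_adj unfolding F_def using V V'
    by (subst mult_four_block_mat[of _ 1 1 _ m _ m _ _ 1 _ m]) (auto simp: isometry_mat_def)
  also have "\<dots> = 1\<^sub>m n" unfolding n by (rule eq_matI) auto
  finally have F_iso: "isometry_mat F" using F by (simp add: isometry_mat_def)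
  have "mat_adjoint F * A' = four_block_mat A1 A2 (0\<^sub>m m 1) (mat_adjoint V * A3)"
    unfolding F_adj A'_block using V' carr
    by (subst mult_four_block_mat[of _ 1 1 _ m _ m _ _ 1 _ m])
      (auto simp: mult_carrier_mat[of _ m m _ m] right_mult_zero_mat[OF V'])
  then have "mat_adjoint F * A' * F
      = four_block_mat A1 (A2 * V) (0\<^sub>m m 1) (mat_adjoint V * A3 * V)"
    unfolding F_def using V V' carr
    by (simp only:, subst mult_four_block_mat[of _ 1 1 _ m _ m _ _ 1 _ m])
      (auto simp: mult_carrier_mat[of _ m m _ m] mult_carrier_mat[of _ 1 m _ m])
  moreover have "mat_adjoint (W * F) * A * (W * F) = mat_adjoint F * A' * F"
    unfolding A'_def using A W F by (intro mat_adjoint_congruence_mult)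
  moreover have "upper_triangular A1" "diag_mat A1 = [e]"
    by (auto simp: A1_def diag_mat_def)
  moreover have "mat_adjoint V * A3 * V \<in> carrier_mat m m"
    using V' V(1) carr(3) by (intro mult_carrier_mat)
  ultimately show ?case
    using isometry_mat_mult[OF W F F_iso] W F T carr
    by (intro bexI[of _ "W * F"])
      (auto simp: upper_triangular_four_block diag_four_block_mat[of _ 1 _ m])
qed

section \<open>Skew-Hermitian matrices and their compressions\<close>

text \<open>Unlike skew-symmetry, this property survives congruence by complex matrices, such as
  those formed from eigenvectors.\<close>

definition skew_hermitian_mat :: "complex mat \<Rightarrow> bool" where
  "skew_hermitian_mat A \<longleftrightarrow> mat_adjoint A = - A"

lemma skew_hermitian_congruence:
  assumes A: "A \<in> carrier_mat n n" "skew_hermitian_mat A" and U: "U \<in> carrier_mat n m"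
  shows "skew_hermitian_mat (mat_adjoint U * A * U)"
proof -
  note carr = A(1) U mat_adjoint_carrier[OF U]
  have AU: "mat_adjoint U * A \<in> carrier_mat m n" using carr by (intro mult_carrier_mat)
  have "mat_adjoint (mat_adjoint U * A * U) = mat_adjoint U * (- A * U)"
    using carr AU A(2)
    by (simp add: mat_adjoint_mult[of _ m n _ m] mat_adjoint_mult[of _ m n _ n] skew_hermitian_mat_def)
  also have "\<dots> = - (mat_adjoint U * (A * U))"
    using carr by (simp add: uminus_mult_left_mat uminus_mult_right_mat)
  also have "mat_adjoint U * (A * U) = mat_adjoint U * A * U"
    using carr by (intro assoc_mult_mat[symmetric])
  finally show ?thesis unfolding skew_hermitian_mat_def .
qed

text \<open>Skewness reflects the zeros below the diagonal of the Schur form to those above it, and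
  on the diagonal it reads \<open>cnj d = - d\<close>, which makes \<open>d\<close> purely
  imaginary.\<close>

lemma skew_hermitian_unitarily_diagonalizable:
  assumes A: "A \<in> carrier_mat n n" "skew_hermitian_mat A"
    and cp: "char_poly A = (\<Prod>e\<leftarrow>es. [:- e, 1:])"
  shows "\<exists>U \<in> carrier_mat n n. isometry_mat U \<and>
    mat_adjoint U * A * U = mat n n (\<lambda>(i, j). if i = j then es ! i else 0)"
    and "length es = n" and "\<And>e. e \<in> set es \<Longrightarrow> Re e = 0"
proof -
  from unitary_schur_decomposition[OF A(1) cp] obtain U where U: "U \<in> carrier_mat n n" "isometry_mat U"
    and T: "upper_triangular (mat_adjoint U * A * U)" "diag_mat (mat_adjoint U * A * U) = es" by blast
  define T where "T = mat_adjoint U * A * U"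
  have carr: "T \<in> carrier_mat n n"
    unfolding T_def using U A mat_adjoint_carrier[OF U(1)] by (intro mult_carrier_mat)
  have T_skew: "mat_adjoint T = - T"
    using skew_hermitian_congruence[OF A U(1)] unfolding T_def skew_hermitian_mat_def .
  have skew: "cnj (T $$ (j, i)) = - T $$ (i, j)" if "i < n" "j < n" for i j
    using arg_cong[OF T_skew, of "\<lambda>M. M $$ (i, j)"] that carr by simp
  show len: "length es = n"
    using T(2) carr unfolding T_def[symmetric] diag_mat_def by auto
  have diag: "T $$ (i, i) = es ! i" if "i < n" for i
    using T(2) carr that unfolding T_def[symmetric] diag_mat_def by auto
  have lower: "T $$ (i, j) = 0" if "j < i" "i < n" for i j
    using T(1) carr that unfolding T_def[symmetric] upper_triangular_def by auto
  have "T $$ (i, j) = 0" if "i < n" "j < n" "i \<noteq> j" for i j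
    using lower[of j i] lower[of i j] skew[of i j] that by (cases "j < i") auto
  then have "T = mat n n (\<lambda>(i, j). if i = j then es ! i else 0)"
    using carr diag by (intro eq_matI) auto
  then show "\<exists>U \<in> carrier_mat n n. isometry_mat U \<and>
      mat_adjoint U * A * U = mat n n (\<lambda>(i, j). if i = j then es ! i else 0)"
    using U unfolding T_def by blast
  show "Re e = 0" if "e \<in> set es" for e
  proof -
    from that len obtain i where "i < n" "e = es ! i" by (auto simp: in_set_conv_nth)
    with skew[of i i] diag show ?thesis by (auto simp: complex_eq_iff)
  qed
qed

lemma imag_le_iff: "imag_le a b \<longleftrightarrow> Im a \<le> Im b"
  by (simp add: imag_le_def)

text \<open>Eigenbases of the matrix and of its compression reduce the claim to the diagonal case,
  with the imaginary parts as real weights. For \<open>m = n - 1\<close> the shift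
  \<open>n - m\<close> is 1.\<close>

lemma skew_hermitian_cauchy_interlacing:
  assumes A: "A \<in> carrier_mat n n" "skew_hermitian_mat A"
    and E: "E \<in> carrier_mat n m" "isometry_mat E" and "m \<le> n"
    and cpA: "char_poly A = (\<Prod>e\<leftarrow>ls. [:- e, 1:])"
    and cpB: "char_poly (mat_adjoint E * A * E) = (\<Prod>e\<leftarrow>ms. [:- e, 1:])"
    and sorted: "sorted_wrt imag_le ls" "sorted_wrt imag_le ms"
    and "k < m"
  shows "imag_le (ls ! k) (ms ! k)" "imag_le (ms ! k) (ls ! (k + (n - m)))"
proof -
  define B where "B = mat_adjoint E * A * E"
  have B: "B \<in> carrier_mat m m"
    unfolding B_def using A E mat_adjoint_carrier[OF E(1)] by (intro mult_carrier_mat)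
  have "skew_hermitian_mat B" unfolding B_def by (rule skew_hermitian_congruence[OF A E(1)])
  note B = B this
  note specA = skew_hermitian_unitarily_diagonalizable[OF A cpA]
  note specB = skew_hermitian_unitarily_diagonalizable[OF B cpB[folded B_def]]
  define D where "D = mat n n (\<lambda>(i, j). if i = j then ls ! i else 0)"
  from specA(1) obtain U where U: "U \<in> carrier_mat n n" "isometry_mat U"
    and UAU: "mat_adjoint U * A * U = D" unfolding D_def by blast
  from specB(1) obtain V where V: "V \<in> carrier_mat m m" "isometry_mat V"
    and VBV: "mat_adjoint V * B * V = mat m m (\<lambda>(i, j). if i = j then ms ! i else 0)" by blast
  have EV: "E * V \<in> carrier_mat n m" "isometry_mat (E * V)"
    using E V isometry_mat_mult by auto
  have U': "mat_adjoint U \<in> carrier_mat n n" using U by simp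
  \<comment> \<open>The embedded eigenbasis \<open>E * V\<close> of \<open>B\<close>, in coordinates
    of the eigenbasis \<open>U\<close> of \<open>A\<close>.\<close>
  define X where "X = mat_adjoint U * (E * V)"
  have X: "X \<in> carrier_mat n m" unfolding X_def using U' EV(1) by (rule mult_carrier_mat)
  have X_iso: "isometry_mat X"
    unfolding X_def using isometry_mat_adjoint[OF U] U' EV isometry_mat_mult by blast
  have "U * X = U * mat_adjoint U * (E * V)"
    unfolding X_def using U(1) U' EV(1) by (intro assoc_mult_mat[symmetric])
  then have UX: "U * X = E * V"
    using isometry_mat_adjoint(1)[OF U] left_mult_one_mat[OF EV(1)] by simp
  \<comment> \<open>As \<open>U * X = E * V\<close>, the congruence of \<open>D\<close> by
    \<open>X\<close> is that of \<open>A\<close> by \<open>E * V\<close>, hence that of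
    \<open>B\<close> by \<open>V\<close>.\<close>
  have "mat_adjoint X * D * X = mat_adjoint (E * V) * A * (E * V)"
    unfolding UAU[symmetric] UX[symmetric] by (rule mat_adjoint_congruence_mult[OF U(1) X A(1), symmetric])
  also have "\<dots> = mat m m (\<lambda>(i, j). if i = j then ms ! i else 0)"
    unfolding mat_adjoint_congruence_mult[OF E(1) V(1) A(1)] VBV[symmetric] B_def ..
  finally have XDX: "mat_adjoint X * D * X = mat m m (\<lambda>(i, j). if i = j then ms ! i else 0)" .
  have D: "D \<in> carrier_mat n n" unfolding D_def by simp
  have DX_carr: "D * X \<in> carrier_mat n m" using D X by (rule mult_carrier_mat)
  have DX: "(D * X) $$ (r, j) = ls ! r * X $$ (r, j)" if "r < n" "j < m" for r j
  proof -
    have "(D * X) $$ (r, j) = (\<Sum>s<n. (if r = s then ls ! r else 0) * X $$ (s, j))"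
      unfolding index_mult_mat_sum[OF D X that] using that by (intro sum.cong) (auto simp: D_def)
    also have "\<dots> = (\<Sum>s<n. if r = s then ls ! r * X $$ (r, j) else 0)"
      by (intro sum.cong) auto
    finally show ?thesis using that by simp
  qed
  have pure: "z = \<i> * of_real (Im z)" if "z \<in> set ls \<union> set ms" for z
    using that specA(3) specB(3) by (auto simp: complex_eq_iff)
  have "(\<Sum>r<n. cnj (X $$ (r, i)) * X $$ (r, j) * of_real (Im (ls ! r)))
      = (if i = j then of_real (Im (ms ! i)) else 0)" if ij: "i < m" "j < m" for i j
  proof -
    \<comment> \<open>Multiplying by \<open>\<i>\<close> turns the real weights back into
      eigenvalues, so the sum becomes an entry of the diagonalized matrix; \<open>\<i>\<close> is
      cancelled at the end.\<close>
    have "\<i> * (\<Sum>r<n. cnj (X $$ (r, i)) * X $$ (r, j) * of_real (Im (ls ! r)))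
        = (\<Sum>r<n. cnj (X $$ (r, i)) * ((\<i> * of_real (Im (ls ! r))) * X $$ (r, j)))"
      by (simp add: sum_distrib_left ac_simps)
    also have "\<dots> = (\<Sum>r<n. cnj (X $$ (r, i)) * (D * X) $$ (r, j))"
      using ij specA(2) pure by (intro sum.cong refl) (simp add: DX flip: pure)
    also have "\<dots> = (mat_adjoint X * (D * X)) $$ (i, j)"
      using ij X by (simp add: index_mult_mat_sum[OF mat_adjoint_carrier[OF X] DX_carr] del: index_mult_mat)
    also have "mat_adjoint X * (D * X) = mat_adjoint X * D * X"
      using X D mat_adjoint_carrier[OF X] by (intro assoc_mult_mat[symmetric])
    also have "\<dots> $$ (i, j) = (if i = j then ms ! i else 0)"
      unfolding XDX using ij by simp
    also have "\<dots> = \<i> * (if i = j then of_real (Im (ms ! i)) else 0)"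
      using pure[of "ms ! i"] ij specB(2) by auto
    finally show ?thesis by (simp only: mult_cancel_left complex_i_not_zero simp_thms)
  qed
  moreover have "(\<Sum>r<n. cnj (X $$ (r, i)) * X $$ (r, j)) = (if i = j then 1 else 0)"
    if "i < m" "j < m" for i j
    using X_iso isometry_mat_iff[OF X] that by blast
  moreover have "Im (ls ! i) \<le> Im (ls ! j)" if "i \<le> j" "j < n" for i j
    using sorted(1) that specA(2) unfolding sorted_wrt_iff_nth_less imag_le_iff
    by (cases "i = j") auto
  moreover have "Im (ms ! i) \<le> Im (ms ! j)" if "i \<le> j" "j < m" for i j
    using sorted(2) that specB(2) unfolding sorted_wrt_iff_nth_less imag_le_iff
    by (cases "i = j") auto
  ultimately show "imag_le (ls ! k) (ms ! k)" "imag_le (ms ! k) (ls ! (k + (n - m)))"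
    unfolding imag_le_iff
    using cauchy_interlacing_diagonal[where m = m and n = n and k = k and X = "\<lambda>r i. X $$ (r, i)"
        and l = "\<lambda>r. Im (ls ! r)" and u = "\<lambda>r. Im (ms ! r)"]
      \<open>m \<le> n\<close> \<open>k < m\<close> by auto
qed

section \<open>Principal submatrices and sorted spectra\<close>

text \<open>The columns of \<open>E\<close> are the standard basis vectors with index in
  \<open>I\<close>, in increasing order. They are orthonormal because \<open>pick I\<close> is
  injective below \<open>card I\<close>.\<close>

lemma submatrix_as_congruence:
  fixes A :: "complex mat"
  assumes A: "A \<in> carrier_mat n n" and I: "I \<subseteq> {..<n}"
  shows "\<exists>E \<in> carrier_mat n (card I). isometry_mat E \<and> mat_adjoint E * A * E = submatrix A I I"
proof -
  have fin: "finite I" using I finite_subset by blast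
  have pick: "pick I i < n" if "i < card I" for i
    using pick_in_set_le[OF that] I by auto
  have inj: "pick I i = pick I j \<longleftrightarrow> i = j" if "i < card I" "j < card I" for i j
    using pick_mono_le[of i I j] pick_mono_le[of j I i] that by (metis less_irrefl linorder_neqE_nat)
  define E where "E = mat n (card I) (\<lambda>(r, i). if r = pick I i then 1 else 0 :: complex)"
  have E: "E \<in> carrier_mat n (card I)" unfolding E_def by simp
  have E_entry: "E $$ (r, i) = (if r = pick I i then 1 else 0)" if "r < n" "i < card I" for r i
    unfolding E_def using that by simp
  have "isometry_mat E"
    unfolding isometry_mat_iff[OF E] using pick inj
    by (auto simp: E_entry if_distrib[of cnj] if_distrib[of "\<lambda>x. x * _"] cong: if_cong)
  moreover have "mat_adjoint E * A * E = submatrix A I I"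
  proof (rule eq_matI)
    \<comment> \<open>The dimensions of \<open>submatrix\<close> count only the indices within
      range, here all of \<open>I\<close>.\<close>
    have card_I: "{i. i < n \<and> i \<in> I} = I" using I by auto
    then have dim: "dim_row (submatrix A I I) = card I" "dim_col (submatrix A I I) = card I"
      using A by (auto simp: dim_submatrix)
    then show "dim_row (mat_adjoint E * A * E) = dim_row (submatrix A I I)"
      "dim_col (mat_adjoint E * A * E) = dim_col (submatrix A I I)" using E by auto
    fix i j assume "i < dim_row (submatrix A I I)" "j < dim_col (submatrix A I I)"
    then have ij: "i < card I" "j < card I" using dim by auto
    have EA_carr: "mat_adjoint E * A \<in> carrier_mat (card I) n"
      using mat_adjoint_carrier[OF E] A by (rule mult_carrier_mat)
    have EA: "(mat_adjoint E * A) $$ (i, s) = A $$ (pick I i, s)" if "s < n" for s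
    proof -
      have "(mat_adjoint E * A) $$ (i, s) = (\<Sum>r<n. cnj (E $$ (r, i)) * A $$ (r, s))"
        using ij that A E by (simp add: scalar_prod_def atLeast0LessThan)
      also have "\<dots> = (\<Sum>r<n. if r = pick I i then A $$ (r, s) else 0)"
        using ij by (intro sum.cong) (auto simp: E_entry)
      finally show ?thesis using pick ij by simp
    qed
    have "(mat_adjoint E * A * E) $$ (i, j) = (\<Sum>s<n. (mat_adjoint E * A) $$ (i, s) * E $$ (s, j))"
      using ij EA_carr E by (rule index_mult_mat_sum[rotated 2])
    also have "\<dots> = (\<Sum>s<n. if s = pick I j then A $$ (pick I i, s) else 0)"
      using ij by (intro sum.cong) (auto simp: EA E_entry)
    also have "\<dots> = A $$ (pick I i, pick I j)" using pick ij by simp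
    also have "\<dots> = submatrix A I I $$ (i, j)"
      using ij A card_I by (simp add: submatrix_index)
    finally show "(mat_adjoint E * A * E) $$ (i, j) = submatrix A I I $$ (i, j)" .
  qed
  ultimately show ?thesis using E by blast
qed

lemma map_mat_submatrix:
  "map_mat f (submatrix A I J) = submatrix (map_mat f A) I J"
  by (rule eq_matI) (auto simp: dim_submatrix submatrix_index pick_le)

lemma proots_linear_factors: "proots (\<Prod>a\<leftarrow>as. [:- a, 1:]) = mset (as :: 'a :: idom list)"
proof (induction as)
  case (Cons a as)
  have "(\<Prod>a\<leftarrow>as. [:- a, 1:]) \<noteq> 0" by (auto simp: prod_list_zero_iff)
  then have "proots ([:- a, 1:] * (\<Prod>a\<leftarrow>as. [:- a, 1:])) = {#a#} + mset as"
    using Cons.IH by (subst proots_mult) auto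
  then show ?case by (simp only: list.map prod_list.Cons) simp
qed simp

text \<open>The characteristic polynomial splits over the complex numbers, and the product of its
  linear factors is independent of their order, so the roots can be sorted by \<open>Im\<close>. One
  list then serves both the Schur form and \<open>interlaces\<close>.\<close>

lemma eigenvalue_mset_sorted_list:
  assumes "A \<in> carrier_mat n n"
  shows "\<exists>es. char_poly (map_mat complex_of_real A) = (\<Prod>e\<leftarrow>es. [:- e, 1:]) \<and>
    mset es = eigenvalue_mset A \<and> sorted_wrt imag_le es"
proof -
  have "map_mat complex_of_real A \<in> carrier_mat n n" using assms by simp
  from char_poly_factorized[OF this] obtain as
    where as: "char_poly (map_mat complex_of_real A) = (\<Prod>a\<leftarrow>as. [:- a, 1:])" by blast
  define es where "es = sort_key Im as"
  have perm: "mset es = mset as" unfolding es_def by simp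
  have "(\<Prod>e\<leftarrow>es. [:- e, 1:]) = (\<Prod>a\<leftarrow>as. [:- a, 1:])"
    by (metis perm mset_map prod_mset_prod_list)
  moreover have "sorted_wrt imag_le es"
    using sorted_sort_key[of Im as] unfolding es_def by (simp add: sorted_map imag_le_iff[abs_def])
  ultimately show ?thesis
    using as perm unfolding eigenvalue_mset_def by (metis proots_linear_factors)
qed

section \<open>Real skew-symmetric matrices\<close>

theorem theorem1p1:
  fixes A B :: "real mat" and n :: nat
  assumes "n \<ge> 1"
    and "A \<in> carrier_mat n n"
    and "skew_symmetric_mat A"
    and "B \<in> carrier_mat (n - 1) (n - 1)"
    and "principal_submatrix B A"
  shows "interlaces (eigenvalue_mset B) (eigenvalue_mset A)"
proof -
  let ?c = "map_mat complex_of_real"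
  have A: "?c A \<in> carrier_mat n n" using assms(2) by simp
  have transpose_A: "transpose_mat A = - A" using assms(3) by (simp add: skew_symmetric_mat_def)
  \<comment> \<open>Conjugation fixes the real entries, so the adjoint of \<open>?c A\<close> is its
    transpose.\<close>
  have skew: "skew_hermitian_mat (?c A)"
    unfolding skew_hermitian_mat_def
  proof (rule eq_matI)
    fix i j assume "i < dim_row (- ?c A)" "j < dim_col (- ?c A)"
    then have ij: "i < n" "j < n" using assms(2) by auto
    have "A $$ (j, i) = - A $$ (i, j)"
      using arg_cong[OF transpose_A, of "\<lambda>M. M $$ (i, j)"] ij assms(2) by simp
    then show "mat_adjoint (?c A) $$ (i, j) = (- ?c A) $$ (i, j)"
      using ij assms(2) by simp
  qed (use assms(2) in auto)
  obtain I where I: "I \<subseteq> {..<n}" and B: "B = submatrix A I I"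
    using assms(5) unfolding principal_submatrix_def carrier_matD(1)[OF assms(2)] by blast
  \<comment> \<open>The definition of \<open>principal_submatrix\<close> admits any index set; the
    size of \<open>B\<close> forces \<open>I\<close> to omit exactly one index.\<close>
  have "{i. i < n \<and> i \<in> I} = I" using I by auto
  then have card_I: "card I = n - 1"
    using carrier_matD(1)[OF assms(2)] carrier_matD(1)[OF assms(4)]
    unfolding B by (simp add: dim_submatrix)
  from submatrix_as_congruence[OF A I] obtain E
    where E: "E \<in> carrier_mat n (n - 1)" "isometry_mat E" and EAE: "mat_adjoint E * ?c A * E = ?c B"
    unfolding B map_mat_submatrix card_I by blast
  obtain ls where ls: "char_poly (?c A) = (\<Prod>e\<leftarrow>ls. [:- e, 1:])"
    "mset ls = eigenvalue_mset A" "sorted_wrt imag_le ls"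
    using eigenvalue_mset_sorted_list[OF assms(2)] by blast
  obtain ms where ms: "char_poly (?c B) = (\<Prod>e\<leftarrow>ms. [:- e, 1:])"
    "mset ms = eigenvalue_mset B" "sorted_wrt imag_le ms"
    using eigenvalue_mset_sorted_list[OF assms(4)] by blast
  have skewB: "skew_hermitian_mat (?c B)"
    using skew_hermitian_congruence[OF A skew E(1)] unfolding EAE .
  have B': "?c B \<in> carrier_mat (n - 1) (n - 1)" using assms(4) by simp
  note specA = skew_hermitian_unitarily_diagonalizable(2,3)[OF A skew ls(1)]
  note specB = skew_hermitian_unitarily_diagonalizable(2,3)[OF B' skewB ms(1)]
  have axis: "z \<in> imaginary_axis" if "Re z = 0" for z
    using that unfolding imaginary_axis_def by (auto simp: complex_eq_iff intro!: exI[of _ "Im z"])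
  \<comment> \<open>Since \<open>n\<close> is at least 1, the shift \<open>n - (n - 1)\<close>
    equals 1, which gives the index \<open>Suc k\<close>.\<close>
  have "imag_le (ls ! k) (ms ! k)" "imag_le (ms ! k) (ls ! Suc k)" if "k < n - 1" for k
    using skew_hermitian_cauchy_interlacing[OF A skew E _ ls(1) _ ls(3) ms(3) that] ms(1) assms(1)
    unfolding EAE by auto
  moreover have "set_mset (eigenvalue_mset A) \<subseteq> imaginary_axis" "set_mset (eigenvalue_mset B) \<subseteq> imaginary_axis"
    using specA(2) specB(2) axis unfolding ls(2)[symmetric] ms(2)[symmetric] by auto
  ultimately show ?thesis
    unfolding interlaces_def using ls ms specA(1) specB(1) assms(1)
    by (intro conjI exI[of _ ls] exI[of _ ms]) auto
qed

end
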